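(* Let $f:\mathbb{R}^d\to\mathbb{R}$ be differentiable, convex and symmetrically $(L_0,L_1)$-smooth with $L_0>0$, $L_1>0$, and let $x^*\in\arg\min_{x\in\mathbb{R}^d} f(x)$. Let $\nu$ be the real number with $\nu=e^{-\nu}$, let $0<\eta\le\frac{\nu}{2}$, let $x^0\in\mathbb{R}^d$, and let $(x^k)_{k\ge0}$ be the iterates of $(L_0,L_1)$-GD, $$x^{k+1}=x^k-\frac{\eta}{L_0+L_1\|\nabla f(x^k)\|}\nabla f(x^k).$$ Then for every $k\ge0$ $$\|\nabla f(x^k)\|\ge\frac{L_0}{L_1}\ \Longrightarrow\ k\le\frac{8L_1^2\|x^0-x^*\|^2}{\nu\eta}-1\ \text{ and }\ \|x^{k+1}-x^*\|^2\le\|x^k-x^*\|^2-\frac{\nu\eta}{8L_1^2}.$$ Moreover, for every integer $N\ge0$ with $N>\frac{8L_1^2\|x^0-x^*\|^2}{\nu\eta}-1$, the output $x^N$ after $N$ iterations satisfies $$f(x^N)-f(x^* )\le\frac{2L_0\|x^0-x^*\|^2}{\eta(N+1-T)}-\frac{\nu L_0T}{4L_1^2(N+1-T)}\le\frac{2L_0\|x^0-x^*\|^2}{\eta(N+1)},$$ where $T:=|\mathcal{T}|$ and $\mathcal{T}:=\{k\in\{0,1,\ldots,N-1\}\mid\|\nabla f(x^k)\|\ge\frac{L_0}{L_1}\}$. In addition, if $f$ is $\mu$-strongly convex with $\mu>0$ and $N>\frac{8L_1^2\|x^0-x^*\|^2}{\eta}-1$, then $$\|x^N-x^*\|^2\le\Big(1-\frac{\mu\eta}{4L_0}\Big)^{N-T}\Big(\|x^0-x^*\|^2-\frac{\nu\eta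 T}{8L_1^2}\Big)\le\Big(1-\frac{\mu\eta}{4L_0}\Big)^{N-T}\|x^0-x^*\|^2.$$
   Context: $\|\cdot\|$ is the Euclidean norm. A differentiable $f:\mathbb{R}^d\to\mathbb{R}$ is $\mu$-strongly convex ($\mu\ge0$) if $f(y)\ge f(x)+\langle\nabla f(x),y-x\rangle+\frac\mu2\|x-y\|^2$ for all $x,y\in\mathbb{R}^d$; convex means $\mu=0$. It is symmetrically $(L_0,L_1)$-smooth if for all $x,y\in\mathbb{R}^d$ $$\|\nabla f(x)-\nabla f(y)\|\le\Big(L_0+L_1\sup_{u\in[x,y]}\|\nabla f(u)\|\Big)\|x-y\|,$$ where $[x,y]$ is the line segment between $x$ and $y$. *)

theory Defs
  imports "HOL-Analysis.Analysis"
begin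

definition grad :: "('a::real_inner \<Rightarrow> real) \<Rightarrow> 'a \<Rightarrow> 'a" where
  "grad f x = (THE g. GDERIV f x :> g)"

text \<open>Convexity of a differentiable function is \<open>strongly_convex 0\<close>. Like the next definition,
  this is meaningful only for functions that are differentiable everywhere.\<close>

definition strongly_convex :: "real \<Rightarrow> ('a::real_inner \<Rightarrow> real) \<Rightarrow> bool" where
  "strongly_convex \<mu> f \<longleftrightarrow>
     (\<forall>x y. f y \<ge> f x + grad f x \<bullet> (y - x) + \<mu> / 2 * (norm (x - y))\<^sup>2)"

text \<open>The supremum is taken in the extended reals, because the supremum of an unbounded set of
  reals is unspecified.\<close>

definition sym_smooth :: "real \<Rightarrow> real \<Rightarrow> ('a::real_inner \<Rightarrow> real) \<Rightarrow> bool" where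
  "sym_smooth L\<^sub>0 L\<^sub>1 f \<longleftrightarrow>
     (\<forall>x y. ereal (norm (grad f x - grad f y))
        \<le> (ereal L\<^sub>0 + ereal L\<^sub>1 * (SUP u\<in>closed_segment x y. ereal (norm (grad f u))))
            * ereal (norm (x - y)))"

end

theory Submission
  imports Defs
begin

text \<open>Write \<open>A u = L\<^sub>0 + L\<^sub>1 * norm (grad f u)\<close>. Smoothness makes \<open>A\<close> grow at most like
  \<open>exp (L\<^sub>1 * distance)\<close>, and \<open>\<nu>\<close> is chosen so that steps of length at most \<open>\<nu> / L\<^sub>1\<close> cost a
  factor \<open>exp \<nu> = 1 / \<nu>\<close> at most. A local cocoercivity inequality follows, and it makes the gradient
  norms nonincreasing along the iterates. The indices with large gradient therefore form an initial
  segment; on it the squared distance to the minimizer drops by a constant, and afterwards by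
  \<open>\<eta> / (2 * L\<^sub>0)\<close> times the (nonincreasing) function gap.\<close>

section \<open>Existence and uniqueness of the gradient\<close>

lemma GDERIV_unique:
  assumes "GDERIV f u :> g" "GDERIV f u :> h"
  shows "g = h"
proof -
  have "(\<lambda>v. v \<bullet> g) = (\<lambda>v. v \<bullet> h)"
    using assms unfolding gderiv_def by (rule has_derivative_unique)
  then show ?thesis by (metis inner_commute vector_eq_rdot)
qed

lemma differentiable_GDERIV_grad:
  fixes f :: "'a::euclidean_space \<Rightarrow> real"
  assumes "f differentiable (at u)"
  shows "GDERIV f u :> grad f u"
proof -
  obtain f' where f': "(f has_derivative f') (at u)"
    using assms by (auto simp: differentiable_def)
  then have "linear f'" by (rule has_derivative_linear)
  \<comment> \<open>\<open>adjoint f' 1\<close> is the Riesz vector of the linear functional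
    \<open>f'\<close>.\<close>
  then have "f' v = v \<bullet> adjoint f' 1" for v
    using adjoint_works[of f' v 1] by (simp add: inner_commute)
  then have "f' = (\<lambda>v. v \<bullet> adjoint f' 1)" by blast
  with f' have "GDERIV f u :> adjoint f' 1" unfolding gderiv_def by simp
  then show ?thesis unfolding grad_def by (rule theI) (rule GDERIV_unique[OF _ \<open>GDERIV f u :> adjoint f' 1\<close>])
qed

section \<open>Growth of the gradient norm\<close>

locale convex_sym_smooth =
  fixes f :: "'a::euclidean_space \<Rightarrow> real" and L\<^sub>0 L\<^sub>1 :: real
  assumes diff: "f differentiable_on UNIV"
    and convex: "strongly_convex 0 f"
    and L0_pos: "L\<^sub>0 > 0" and L1_pos: "L\<^sub>1 > 0"
    and smooth: "sym_smooth L\<^sub>0 L\<^sub>1 f"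
begin

abbreviation g :: "'a \<Rightarrow> 'a" where "g \<equiv> grad f"

definition A :: "'a \<Rightarrow> real" where "A u = L\<^sub>0 + L\<^sub>1 * norm (g u)"

lemma A_pos: "A u > 0" and A_ge_norm: "A u \<ge> L\<^sub>1 * norm (g u)"
  using L0_pos L1_pos by (auto simp: A_def add_pos_nonneg)

lemma GDERIV_g: "GDERIV f u :> g u"
  using diff by (intro differentiable_GDERIV_grad) (simp add: differentiable_on_def)

lemma convexD: "f v \<ge> f u + g u \<bullet> (v - u)"
  using convex by (simp add: strongly_convex_def)

text \<open>Makes real suprema of gradient norms over segments meaningful. A unit step from
  \<open>u\<close> along the gradient raises the supporting hyperplane at \<open>u\<close> by
  \<open>norm (g u)\<close>, while \<open>f\<close> itself is bounded on a ball.\<close>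

lemma bounded_grad_image:
  assumes "bounded S"
  obtains M where "\<And>u. u \<in> S \<Longrightarrow> norm (g u) \<le> M"
proof -
  obtain R where R: "\<And>u. u \<in> S \<Longrightarrow> norm u \<le> R"
    using assms by (auto simp: bounded_iff)
  \<comment> \<open>The extra 1 in the radius leaves room for the step
    \<open>sgn (g u)\<close>.\<close>
  have "continuous_on (cball 0 (R + 1)) f"
    using diff differentiable_imp_continuous_on differentiable_on_subset by blast
  then have "bounded (f ` cball 0 (R + 1))"
    by (intro compact_imp_bounded compact_continuous_image) auto
  then obtain B where B: "\<And>u. norm u \<le> R + 1 \<Longrightarrow> \<bar>f u\<bar> \<le> B"
    unfolding bounded_iff by (metis image_eqI mem_cball_0 real_norm_def)
  have "norm (g u) \<le> 2 * B" if "u \<in> S" for u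
  proof -
    have u: "norm u \<le> R" using R that by blast
    have "norm (u + sgn (g u)) \<le> norm u + 1"
      by (rule norm_triangle_le) (simp add: norm_sgn)
    then have "\<bar>f (u + sgn (g u))\<bar> \<le> B" using u by (intro B) linarith
    moreover have "\<bar>f u\<bar> \<le> B" using u by (intro B) linarith
    moreover have "g u \<bullet> sgn (g u) = norm (g u)"
      by (cases "g u = 0")
        (simp_all add: sgn_div_norm power2_norm_eq_inner[symmetric] power2_eq_square)
    then have "f (u + sgn (g u)) \<ge> f u + norm (g u)"
      using convexD[of u "u + sgn (g u)"] by simp
    ultimately show ?thesis by linarith
  qed
  then show thesis by (rule that)
qed

text \<open>Passes from the extended-real supremum to real arithmetic: any uniform bound on the
  segment may replace it.\<close>

lemma grad_diff_le:
  assumes "\<And>w. w \<in> closed_segment u v \<Longrightarrow> norm (g w) \<le> M"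
  shows "norm (g u - g v) \<le> (L\<^sub>0 + L\<^sub>1 * M) * norm (u - v)"
proof -
  have "(SUP w\<in>closed_segment u v. ereal (norm (g w))) \<le> ereal M"
    using assms by (intro SUP_least) simp
  then have "ereal L\<^sub>1 * (SUP w\<in>closed_segment u v. ereal (norm (g w))) \<le> ereal L\<^sub>1 * ereal M"
    using L1_pos by (intro ereal_mult_left_mono) auto
  then have "(ereal L\<^sub>0 + ereal L\<^sub>1 * (SUP w\<in>closed_segment u v. ereal (norm (g w))))
      * ereal (norm (u - v)) \<le> (ereal L\<^sub>0 + ereal L\<^sub>1 * ereal M) * ereal (norm (u - v))"
    by (intro ereal_mult_right_mono add_left_mono) auto
  with smooth have "ereal (norm (g u - g v)) \<le> (ereal L\<^sub>0 + ereal L\<^sub>1 * ereal M) * ereal (norm (u - v))"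
    unfolding sym_smooth_def by (meson order_trans)
  then show ?thesis by simp
qed

text \<open>The supremum \<open>S\<close> of the gradient norm over the segment bounds itself:
  smoothness between \<open>u\<close> and any point of the segment gives
  \<open>S \<le> norm (g u) + (L\<^sub>0 + L\<^sub>1 * S) * ?d\<close>. For
  \<open>L\<^sub>1 * ?d < 1\<close> this can be solved for \<open>L\<^sub>0 + L\<^sub>1 * S\<close>,
  which dominates \<open>A v\<close>; otherwise the left side is nonpositive.\<close>

lemma A_growth_step: "A v * (1 - L\<^sub>1 * norm (v - u)) \<le> A u"
proof (cases "L\<^sub>1 * norm (v - u) < 1")
  case False
  then have "A v * (1 - L\<^sub>1 * norm (v - u)) \<le> 0"
    using A_pos[of v] by (simp add: mult_le_0_iff)
  then show ?thesis using A_pos[of u] by linarith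
next
  case True
  let ?I = "closed_segment u v" and ?d = "norm (v - u)"
  obtain M where M: "\<And>w. w \<in> ?I \<Longrightarrow> norm (g w) \<le> M"
    using bounded_grad_image[OF bounded_closed_segment] by blast
  define S where "S = (SUP w\<in>?I. norm (g w))"
  have bdd: "bdd_above ((\<lambda>w. norm (g w)) ` ?I)"
    using M by (auto simp: bdd_above_def)
  have S: "norm (g w) \<le> S" if "w \<in> ?I" for w
    unfolding S_def using that bdd by (rule cSUP_upper)
  have "norm (g v) \<le> S" by (simp add: S)
  then have LS: "A v \<le> L\<^sub>0 + L\<^sub>1 * S" using L1_pos by (simp add: A_def)
  then have LS0: "L\<^sub>0 + L\<^sub>1 * S > 0" using A_pos[of v] by linarith
  have "norm (g w) \<le> norm (g u) + (L\<^sub>0 + L\<^sub>1 * S) * ?d" if "w \<in> ?I" for w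
  proof -
    have sub: "closed_segment w u \<subseteq> ?I"
      using that by (simp add: subset_closed_segment)
    have "norm (g w - g u) \<le> (L\<^sub>0 + L\<^sub>1 * S) * norm (w - u)"
      using sub by (intro grad_diff_le S) blast
    also have "\<dots> \<le> (L\<^sub>0 + L\<^sub>1 * S) * ?d"
      using dist_in_closed_segment(1)[OF that] LS0
      by (intro mult_left_mono) (auto simp: dist_norm norm_minus_commute)
    finally show ?thesis using norm_triangle_sub[of "g w" "g u"] by linarith
  qed
  then have "S \<le> norm (g u) + (L\<^sub>0 + L\<^sub>1 * S) * ?d"
    unfolding S_def by (intro cSUP_least) auto
  then have "L\<^sub>1 * S \<le> L\<^sub>1 * (norm (g u) + (L\<^sub>0 + L\<^sub>1 * S) * ?d)"
    using L1_pos by simp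
  then have "(L\<^sub>0 + L\<^sub>1 * S) * (1 - L\<^sub>1 * ?d) \<le> A u"
    by (simp add: A_def algebra_simps)
  moreover have "A v * (1 - L\<^sub>1 * ?d) \<le> (L\<^sub>0 + L\<^sub>1 * S) * (1 - L\<^sub>1 * ?d)"
    using LS True by (intro mult_right_mono) auto
  ultimately show ?thesis by linarith
qed

text \<open>A discrete Gronwall argument: the segment is cut into \<open>n\<close> equal pieces and \<open>n\<close> tends to
  infinity, so no continuity of the gradient is needed.\<close>

lemma A_growth: "A v \<le> A u * exp (L\<^sub>1 * norm (v - u))"
proof -
  define c where "c = L\<^sub>1 * norm (v - u)"
  have c0: "c \<ge> 0" using L1_pos by (simp add: c_def)
  have step: "A v * (1 + (-c) / real n) ^ n \<le> A u" if n: "real n > c" for n :: nat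
  proof -
    have n0: "real n > 0" using n c0 by linarith
    \<comment> \<open>Nonnegative factors allow the one-piece inequalities to be multiplied
      together.\<close>
    have cn: "1 + (-c) / real n \<ge> 0" using n n0 by (simp add: field_simps)
    define w where "w k = u + (real k / real n) *\<^sub>R (v - u)" for k :: nat
    have "A (w k) * (1 + (-c) / real n) ^ k \<le> A u" for k
    proof (induction k)
      case 0 then show ?case by (simp add: w_def)
    next
      case (Suc k)
      have "w (Suc k) - w k = (1 / real n) *\<^sub>R (v - u)"
        by (simp add: w_def scaleR_left_diff_distrib[symmetric] diff_divide_distrib[symmetric])
      then have "1 - L\<^sub>1 * norm (w (Suc k) - w k) = 1 + (-c) / real n"
        by (simp add: c_def)
      then have "A (w (Suc k)) * (1 + (-c) / real n) \<le> A (w k)"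
        using A_growth_step[of "w (Suc k)" "w k"] by simp
      then have "A (w (Suc k)) * (1 + (-c) / real n) * (1 + (-c) / real n) ^ k
          \<le> A (w k) * (1 + (-c) / real n) ^ k"
        using cn by (intro mult_right_mono) auto
      with Suc show ?case by (simp add: mult.assoc)
    qed
    from this[of n] show ?thesis using n0 by (simp add: w_def)
  qed
  obtain N :: nat where "c < real N" using reals_Archimedean2 by blast
  then have "\<forall>n\<ge>N. A v * (1 + (-c) / real n) ^ n \<le> A u"
    by (intro allI impI step) linarith
  moreover have "(\<lambda>n. A v * (1 + (-c) / real n) ^ n) \<longlonglongrightarrow> A v * exp (-c)"
    by (intro tendsto_mult_left tendsto_exp_limit_sequentially)
  ultimately have "A v * exp (-c) \<le> A u" by (blast intro: LIMSEQ_le_const2)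
  then show ?thesis by (simp add: exp_minus field_simps c_def)
qed

text \<open>Each point of the segment is within \<open>norm (v - u)\<close> of \<open>u\<close>, so
  \<open>A_growth\<close> bounds \<open>A\<close> by one constant \<open>K\<close> on all of
  it.\<close>

lemma grad_diff_exp:
  "norm (g v - g u) \<le> A u * exp (L\<^sub>1 * norm (v - u)) * norm (v - u)"
proof -
  define K where "K = A u * exp (L\<^sub>1 * norm (v - u))"
  \<comment> \<open>The bound is chosen as the \<open>M\<close> with
    \<open>L\<^sub>0 + L\<^sub>1 * M = K\<close>.\<close>
  have "norm (g w) \<le> (K - L\<^sub>0) / L\<^sub>1" if "w \<in> closed_segment v u" for w
  proof -
    have "norm (w - u) \<le> norm (v - u)"
      using that by (metis segment_bound1 closed_segment_commute norm_minus_commute)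
    then have "A u * exp (L\<^sub>1 * norm (w - u)) \<le> K"
      unfolding K_def using A_pos[of u] L1_pos by (intro mult_left_mono) auto
    then have "A w \<le> K" using A_growth[of w u] by linarith
    then show ?thesis using L1_pos by (simp add: A_def field_simps)
  qed
  then have "norm (g v - g u) \<le> (L\<^sub>0 + L\<^sub>1 * ((K - L\<^sub>0) / L\<^sub>1)) * norm (v - u)"
    by (rule grad_diff_le)
  then show ?thesis using L1_pos by (simp add: K_def)
qed

section \<open>Descent inequalities and cocoercivity\<close>

text \<open>With the exponential frozen at its value for the whole length of the segment, the slope
  of \<open>f\<close> along the segment exceeds its initial value by at most \<open>K * t\<close>.
  Hence \<open>f\<close> minus the quadratic model, \<open>?p\<close>, is nonincreasing on the unit
  interval.\<close>

lemma descent: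
  "f v \<le> f u + g u \<bullet> (v - u) + A u / 2 * exp (L\<^sub>1 * norm (v - u)) * (norm (v - u))\<^sup>2"
proof -
  define h where "h = v - u"
  define K where "K = A u * exp (L\<^sub>1 * norm h) * (norm h)\<^sup>2"
  let ?p = "\<lambda>t. f (u + t *\<^sub>R h) - t * (g u \<bullet> h) - K * t\<^sup>2 / 2"
  have "?p 0 \<ge> ?p 1"
  proof (rule DERIV_nonpos_imp_nonincreasing[where f = ?p])
    fix t :: real assume t: "0 \<le> t" "t \<le> 1"
    have "((\<lambda>t. u + t *\<^sub>R h) has_derivative (\<lambda>s. s *\<^sub>R h)) (at t)"
      by (auto intro!: derivative_eq_intros)
    from has_derivative_compose[OF this GDERIV_g[unfolded gderiv_def]]
    have "((\<lambda>t. f (u + t *\<^sub>R h)) has_real_derivative g (u + t *\<^sub>R h) \<bullet> h) (at t)"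
      by (simp add: has_field_derivative_def inner_commute mult.commute[of _ "h \<bullet> _"])
    then have D: "(?p has_real_derivative g (u + t *\<^sub>R h) \<bullet> h - g u \<bullet> h - K * t) (at t)"
      by (auto intro!: derivative_eq_intros)
    have n: "norm (u + t *\<^sub>R h - u) = t * norm h" using t by simp
    have "L\<^sub>1 * (t * norm h) \<le> L\<^sub>1 * norm h"
      using t L1_pos by (simp add: mult_left_le_one_le)
    then have "exp (L\<^sub>1 * (t * norm h)) \<le> exp (L\<^sub>1 * norm h)" by simp
    then have "A u * exp (L\<^sub>1 * (t * norm h)) * (t * norm h)
        \<le> A u * exp (L\<^sub>1 * norm h) * (t * norm h)"
      using A_pos[of u] t by (intro mult_right_mono mult_left_mono) auto
    with grad_diff_exp[of "u + t *\<^sub>R h" u]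
    have "norm (g (u + t *\<^sub>R h) - g u) \<le> A u * exp (L\<^sub>1 * norm h) * (t * norm h)"
      unfolding n by linarith
    then have "norm (g (u + t *\<^sub>R h) - g u) * norm h
        \<le> A u * exp (L\<^sub>1 * norm h) * (t * norm h) * norm h"
      by (intro mult_right_mono) auto
    also have "\<dots> = K * t" by (simp add: K_def power2_eq_square)
    finally have "(g (u + t *\<^sub>R h) - g u) \<bullet> h \<le> K * t"
      using norm_cauchy_schwarz[of "g (u + t *\<^sub>R h) - g u" h] by linarith
    then show "\<exists>y. DERIV ?p t :> y \<and> y \<le> 0"
      using D by (auto simp: inner_diff_left)
  qed simp
  then show ?thesis by (simp add: h_def K_def)
qed

text \<open>The displacement has length at most \<open>\<nu> / L\<^sub>1\<close>, so the exponential
  in \<open>descent\<close> is at most \<open>exp \<nu> = 1 / \<nu>\<close>, which cancels one of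
  the two factors \<open>\<nu>\<close> in the squared length.\<close>

lemma descent_along:
  assumes nu: "\<nu> = exp (- \<nu>)" and h: "L\<^sub>1 * norm h \<le> A u"
  shows "f (u - (\<nu> / A u) *\<^sub>R h) \<le> f u - \<nu> / A u * (g u \<bullet> h) + \<nu> * (norm h)\<^sup>2 / (2 * A u)"
proof -
  have nu0: "\<nu> > 0" using nu exp_gt_zero[of "-\<nu>"] by linarith
  have Apos: "A u > 0" by (rule A_pos)
  define d where "d = norm (u - (\<nu> / A u) *\<^sub>R h - u)"
  have d: "d = \<nu> * norm h / A u" using nu0 Apos by (simp add: d_def)
  have "L\<^sub>1 * d = \<nu> * (L\<^sub>1 * norm h / A u)" by (simp add: d)
  also have "\<dots> \<le> \<nu>" using nu0 Apos h by (intro mult_left_le) (auto simp: field_simps)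
  finally have "exp (L\<^sub>1 * d) \<le> exp \<nu>" by simp
  also have "\<dots> = 1 / \<nu>" by (subst (2) nu) (simp add: exp_minus field_simps)
  finally have "A u / 2 * exp (L\<^sub>1 * d) * d\<^sup>2 \<le> A u / 2 * (1 / \<nu>) * d\<^sup>2"
    using Apos by (intro mult_right_mono mult_left_mono) auto
  also have "\<dots> = \<nu> * (norm h)\<^sup>2 / (2 * A u)"
    using Apos nu0 by (simp add: d power2_eq_square field_simps)
  finally show ?thesis
    using descent[of "u - (\<nu> / A u) *\<^sub>R h" u] unfolding d_def[symmetric] by simp
qed

text \<open>Compare the value at \<open>v\<close> of the supporting hyperplane at \<open>u\<close> with the descent from \<open>v\<close>
  along the gradient difference.\<close>

lemma cocoercive:
  assumes nu: "\<nu> = exp (- \<nu>)" and h: "L\<^sub>1 * norm (g v - g u) \<le> A v"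
  shows "\<nu> * (norm (g v - g u))\<^sup>2 / (2 * A v) \<le> f v - f u - g u \<bullet> (v - u)"
proof -
  let ?h = "g v - g u" and ?s = "\<nu> / A v"
  have "f u + g u \<bullet> (v - ?s *\<^sub>R ?h - u) \<le> f v - ?s * (g v \<bullet> ?h) + \<nu> * (norm ?h)\<^sup>2 / (2 * A v)"
    using convexD[of u "v - ?s *\<^sub>R ?h"] descent_along[OF assms] by linarith
  moreover have "g u \<bullet> (v - ?s *\<^sub>R ?h - u) = g u \<bullet> (v - u) - ?s * (g u \<bullet> ?h)"
    by (simp add: inner_diff_right)
  \<comment> \<open>The linear terms amount to twice the quadratic remainder, so one copy of it
    survives.\<close>
  moreover have "?s * (g v \<bullet> ?h) - ?s * (g u \<bullet> ?h) = 2 * (\<nu> * (norm ?h)\<^sup>2 / (2 * A v))"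
    by (simp only: right_diff_distrib[symmetric] inner_diff_left[symmetric]
        power2_norm_eq_inner[symmetric]) simp
  ultimately show ?thesis by linarith
qed

end

section \<open>Initial segments of indices\<close>

text \<open>Lets the number of large-gradient indices serve as the threshold index at which they
  end.\<close>

lemma down_closed_eq_lessThan_card:
  fixes P :: "nat \<Rightarrow> bool"
  assumes "\<And>j k. j \<le> k \<Longrightarrow> P k \<Longrightarrow> P j"
  shows "{k \<in> {..<N}. P k} = {..<card {k \<in> {..<N}. P k}}"
proof -
  have "\<exists>T. {k \<in> {..<N}. P k} = {..<T}"
  proof (induction N)
    case 0 then show ?case by (intro exI[of _ 0]) auto
  next
    case (Suc N)
    show ?case
    proof (cases "P N")
      case True
      then have "{k \<in> {..<Suc N}. P k} = {..<Suc N}" using assms[of _ N] by (auto simp: less_Suc_eq_le)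
      then show ?thesis by blast
    next
      case False
      then have "{k \<in> {..<Suc N}. P k} = {k \<in> {..<N}. P k}" by (auto simp: less_Suc_eq)
      then show ?thesis using Suc by simp
    qed
  qed
  then obtain T where T: "{k \<in> {..<N}. P k} = {..<T}" by blast
  show ?thesis by (simp only: T card_lessThan)
qed

section \<open>One-step estimates for the iterates\<close>

locale sym_smooth_gd = convex_sym_smooth f L\<^sub>0 L\<^sub>1
  for f :: "'a::euclidean_space \<Rightarrow> real" and L\<^sub>0 L\<^sub>1 +
  fixes x :: "nat \<Rightarrow> 'a" and xstar :: 'a and \<nu> \<eta> :: real
  assumes minimum: "f xstar \<le> f u"
    and nu: "\<nu> = exp (- \<nu>)"
    and eta_pos: "0 < \<eta>" and eta_le: "\<eta> \<le> \<nu> / 2"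
    and x_Suc: "x (Suc k) = x k - (\<eta> / A (x k)) *\<^sub>R g (x k)"
begin

definition dist2 :: "nat \<Rightarrow> real" where "dist2 k = (norm (x k - xstar))\<^sup>2"

definition gap :: "nat \<Rightarrow> real" where "gap k = f (x k) - f xstar"

definition large :: "nat \<Rightarrow> bool" where "large k \<longleftrightarrow> norm (g (x k)) \<ge> L\<^sub>0 / L\<^sub>1"

lemma nu_pos: "\<nu> > 0"
  using eta_pos eta_le by linarith

lemma nu_less_1: "\<nu> < 1"
proof -
  have "exp (- \<nu>) < exp 0" using nu_pos by (subst exp_less_cancel_iff) simp
  then show ?thesis using nu by simp
qed

lemma dist2_nonneg: "dist2 k \<ge> 0"
  by (simp add: dist2_def)

lemma gap_nonneg: "gap k \<ge> 0"
  using minimum by (simp add: gap_def)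

text \<open>Descent from \<open>u\<close> along its own gradient cannot go below the minimum;
  \<open>A_ge_norm\<close> licenses the step.\<close>

lemma norm_grad_sq_le_gap: "\<nu> * (norm (g u))\<^sup>2 / (2 * A u) \<le> f u - f xstar"
proof -
  have "f xstar \<le> f u - \<nu> / A u * (g u \<bullet> g u) + \<nu> * (norm (g u))\<^sup>2 / (2 * A u)"
    using descent_along[OF nu A_ge_norm, of u] minimum order_trans by blast
  moreover have "\<nu> / A u * (g u \<bullet> g u) = 2 * (\<nu> * (norm (g u))\<^sup>2 / (2 * A u))"
    by (simp add: power2_norm_eq_inner[symmetric])
  ultimately show ?thesis by linarith
qed

lemma grad_xstar: "g xstar = 0"
  using norm_grad_sq_le_gap[of xstar] nu_pos A_pos[of xstar]
  by (simp add: divide_le_0_iff mult_le_0_iff)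

text \<open>In the expanded square, convexity makes the cross term worth
  \<open>- 2 * ?s * gap k\<close>. The quadratic term gives back at most \<open>?s * gap k\<close>,
  by \<open>norm_grad_sq_le_gap\<close> and \<open>2 * \<eta> \<le> \<nu>\<close>.\<close>

lemma dist2_step: "dist2 (Suc k) \<le> dist2 k - \<eta> / A (x k) * gap k"
proof -
  let ?G = "g (x k)" and ?s = "\<eta> / A (x k)"
  have s0: "?s > 0" using eta_pos A_pos by simp
  have "(norm (v - s *\<^sub>R w))\<^sup>2 = (norm v)\<^sup>2 - 2 * (s * (w \<bullet> v)) + s\<^sup>2 * (norm w)\<^sup>2"
    for v w :: 'a and s :: real
    unfolding power2_norm_eq_inner
    by (simp add: inner_diff inner_commute power2_eq_square algebra_simps)
  moreover have "x (Suc k) - xstar = (x k - xstar) - ?s *\<^sub>R ?G" by (simp add: x_Suc)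
  ultimately have "dist2 (Suc k) = dist2 k - 2 * (?s * (?G \<bullet> (x k - xstar))) + ?s\<^sup>2 * (norm ?G)\<^sup>2"
    by (simp only: dist2_def)
  moreover have "?G \<bullet> (x k - xstar) \<ge> gap k"
    using convexD[of "x k" xstar] by (simp add: gap_def inner_diff_right)
  then have "?s * (?G \<bullet> (x k - xstar)) \<ge> ?s * gap k"
    using s0 by (intro mult_left_mono) auto
  moreover have "?s\<^sup>2 * (norm ?G)\<^sup>2 \<le> ?s * gap k"
  proof -
    have "?s\<^sup>2 * (norm ?G)\<^sup>2 = ?s * (2 * \<eta> / \<nu>) * (\<nu> * (norm ?G)\<^sup>2 / (2 * A (x k)))"
      using nu_pos A_pos[of "x k"] by (simp add: power2_eq_square field_simps)
    also have "\<dots> \<le> ?s * (2 * \<eta> / \<nu>) * gap k"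
      unfolding gap_def using less_imp_le[OF s0] eta_pos nu_pos
      by (intro mult_left_mono norm_grad_sq_le_gap mult_nonneg_nonneg) auto
    also have "\<dots> \<le> ?s * 1 * gap k"
      using s0 eta_le nu_pos gap_nonneg
      by (intro mult_right_mono mult_left_mono) (auto simp: field_simps)
    finally show ?thesis by simp
  qed
  ultimately show ?thesis by linarith
qed

text \<open>A large gradient means \<open>?a \<le> 2 * L\<^sub>1 * ?n\<close>. The 8 is the 4 from
  squaring this times the 2 in \<open>norm_grad_sq_le_gap\<close>.\<close>

lemma dist2_large:
  assumes "large k"
  shows "dist2 (Suc k) \<le> dist2 k - \<nu> * \<eta> / (8 * L\<^sub>1\<^sup>2)"
proof -
  let ?n = "norm (g (x k))" and ?a = "A (x k)"
  have "L\<^sub>0 \<le> L\<^sub>1 * ?n" using assms L1_pos by (simp add: large_def field_simps)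
  then have "?a \<le> 2 * L\<^sub>1 * ?n" by (simp add: A_def)
  then have "?a\<^sup>2 \<le> (2 * L\<^sub>1 * ?n)\<^sup>2"
    using A_pos[of "x k"] by (intro power_mono) auto
  then have "\<nu> * \<eta> / (8 * L\<^sub>1\<^sup>2) \<le> \<eta> / ?a * (\<nu> * ?n\<^sup>2 / (2 * ?a))"
    using A_pos[of "x k"] L1_pos nu_pos eta_pos by (simp add: field_simps power2_eq_square)
  also have "\<dots> \<le> \<eta> / ?a * gap k"
    unfolding gap_def using eta_pos A_pos[of "x k"]
    by (intro mult_left_mono norm_grad_sq_le_gap) auto
  finally show ?thesis using dist2_step[of k] by linarith
qed

text \<open>A small gradient keeps the step size above
  \<open>\<eta> / (2 * L\<^sub>0)\<close>.\<close>

lemma dist2_small: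
  assumes "\<not> large k"
  shows "dist2 (Suc k) \<le> dist2 k - \<eta> / (2 * L\<^sub>0) * gap k"
proof -
  have "A (x k) \<le> 2 * L\<^sub>0" using assms L1_pos by (simp add: large_def A_def field_simps)
  then have "\<eta> / (2 * L\<^sub>0) * gap k \<le> \<eta> / A (x k) * gap k"
    using A_pos[of "x k"] eta_pos gap_nonneg
    by (intro mult_right_mono divide_left_mono) auto
  then show ?thesis using dist2_step[of k] by linarith
qed

section \<open>Monotonicity along the iterates\<close>

text \<open>Cocoercivity and the supporting hyperplane at \<open>x k\<close> are added, which
  cancels the function values; \<open>2 * \<eta> \<le> \<nu>\<close> then gives
  \<open>(norm ?D)\<^sup>2 \<le> ?G \<bullet> ?G - ?H \<bullet> ?G\<close>, a rearrangement of the
  claim. The squared difference is kept for \<open>gap_antimono\<close>.\<close>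

lemma norm_grad_step:
  "(norm (g (x (Suc k))))\<^sup>2 + (norm (g (x (Suc k)) - g (x k)))\<^sup>2 \<le> (norm (g (x k)))\<^sup>2"
proof -
  let ?G = "g (x k)" and ?H = "g (x (Suc k))" and ?a = "A (x k)"
  let ?D = "?H - ?G"
  have a: "?a > 0" by (rule A_pos)
  define d where "d = norm (x (Suc k) - x k)"
  have "L\<^sub>1 * d = \<eta> * (L\<^sub>1 * norm ?G / ?a)" using eta_pos a by (simp add: d_def x_Suc)
  also have "\<dots> \<le> \<eta>" using eta_pos a A_ge_norm[of "x k"]
    by (intro mult_left_le) (auto simp: field_simps)
  finally have d: "L\<^sub>1 * d \<le> \<nu>" using eta_le nu_pos by linarith
  \<comment> \<open>This is the hypothesis of \<open>cocoercive\<close>; it comes out with constant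
    exactly 1 because \<open>exp \<nu> * \<nu> = 1\<close>.\<close>
  have "L\<^sub>1 * norm ?D \<le> L\<^sub>1 * (?a * exp (L\<^sub>1 * d) * d)"
    unfolding d_def using L1_pos by (intro mult_left_mono grad_diff_exp) auto
  also have "\<dots> = ?a * (exp (L\<^sub>1 * d) * (L\<^sub>1 * d))" by simp
  also have "\<dots> \<le> ?a * (exp \<nu> * \<nu>)"
    using d a L1_pos by (intro mult_left_mono mult_mono) (auto simp: d_def)
  also have "exp \<nu> * \<nu> = 1" by (subst (2) nu) (simp add: exp_minus)
  finally have "L\<^sub>1 * norm (?G - ?H) \<le> ?a" by (simp add: norm_minus_commute)
  from cocoercive[OF nu this]
  have "\<nu> * (norm ?D)\<^sup>2 / (2 * ?a) \<le> f (x k) - f (x (Suc k)) - ?H \<bullet> (x k - x (Suc k))"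
    by (simp add: norm_minus_commute)
  moreover have "f (x (Suc k)) \<ge> f (x k) + ?G \<bullet> (x (Suc k) - x k)"
    by (rule convexD)
  moreover have "?H \<bullet> (x k - x (Suc k)) = \<eta> / ?a * (?H \<bullet> ?G)"
    and "?G \<bullet> (x (Suc k) - x k) = - (\<eta> / ?a * (?G \<bullet> ?G))"
    by (simp_all add: x_Suc)
  ultimately have "\<nu> * (norm ?D)\<^sup>2 / (2 * ?a) \<le> \<eta> / ?a * (?G \<bullet> ?G) - \<eta> / ?a * (?H \<bullet> ?G)"
    by linarith
  then have "\<nu> * (norm ?D)\<^sup>2 \<le> 2 * \<eta> * (?G \<bullet> ?G - ?H \<bullet> ?G)"
    using a by (simp add: field_simps)
  moreover have "2 * \<eta> * (norm ?D)\<^sup>2 \<le> \<nu> * (norm ?D)\<^sup>2"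
    using eta_le by (intro mult_right_mono) auto
  ultimately have "2 * \<eta> * (norm ?D)\<^sup>2 \<le> 2 * \<eta> * (?G \<bullet> ?G - ?H \<bullet> ?G)" by linarith
  then have "(norm ?D)\<^sup>2 \<le> ?G \<bullet> ?G - ?H \<bullet> ?G" using eta_pos by simp
  then show ?thesis
    unfolding power2_norm_eq_inner by (simp add: inner_diff inner_commute)
qed

lemma norm_grad_antimono: "j \<le> k \<Longrightarrow> norm (g (x k)) \<le> norm (g (x j))"
proof (induction k rule: dec_induct)
  case (step k)
  have "(norm (g (x (Suc k))))\<^sup>2 \<le> (norm (g (x k)))\<^sup>2"
    using norm_grad_step[of k] zero_le_power2[of "norm (g (x (Suc k)) - g (x k))"] by linarith
  then have "norm (g (x (Suc k))) \<le> norm (g (x k))" by (rule power2_le_imp_le) simp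
  with step show ?case by linarith
qed simp

lemma large_mono: "j \<le> k \<Longrightarrow> large k \<Longrightarrow> large j"
  using norm_grad_antimono unfolding large_def by (meson order_trans)

text \<open>\<open>norm_grad_step\<close> forces consecutive gradients to have nonnegative inner
  product, so the supporting hyperplane at the new iterate does not exceed \<open>f (x k)\<close>
  when \<open>f (x (Suc k))\<close> is taken as its base value.\<close>

lemma gap_antimono: "j \<le> k \<Longrightarrow> gap k \<le> gap j"
proof (induction k rule: dec_induct)
  case (step k)
  let ?G = "g (x k)" and ?H = "g (x (Suc k))"
  have "2 * (?H \<bullet> ?G) = (norm ?H)\<^sup>2 + (norm ?G)\<^sup>2 - (norm (?H - ?G))\<^sup>2"
    unfolding power2_norm_eq_inner by (simp add: inner_diff inner_commute)
  then have "?H \<bullet> ?G \<ge> 0" using norm_grad_step[of k] zero_le_power2[of "norm ?H"] by linarith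
  then have "\<eta> / A (x k) * (?H \<bullet> ?G) \<ge> 0" using eta_pos A_pos[of "x k"] by simp
  then have "gap (Suc k) \<le> gap k"
    using convexD[of "x (Suc k)" "x k"] by (simp add: gap_def x_Suc)
  with step show ?case by linarith
qed simp

section \<open>Counting the indices with large gradient\<close>

lemma dist2_all_large:
  assumes "\<And>j. j < k \<Longrightarrow> large j"
  shows "dist2 k \<le> dist2 0 - \<nu> * \<eta> * real k / (8 * L\<^sub>1\<^sup>2)"
  using assms
proof (induction k)
  case (Suc k)
  then have "dist2 k \<le> dist2 0 - \<nu> * \<eta> * real k / (8 * L\<^sub>1\<^sup>2)" and "large k" by auto
  moreover have "\<nu> * \<eta> * real (Suc k) / (8 * L\<^sub>1\<^sup>2)
      = \<nu> * \<eta> * real k / (8 * L\<^sub>1\<^sup>2) + \<nu> * \<eta> / (8 * L\<^sub>1\<^sup>2)"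
    by (simp add: add_divide_distrib[symmetric] distrib_left)
  ultimately show ?case using dist2_large[of k] by linarith
qed simp

lemma large_index_le:
  assumes "large k"
  shows "real k \<le> 8 * L\<^sub>1\<^sup>2 * dist2 0 / (\<nu> * \<eta>) - 1"
proof -
  \<comment> \<open>The indices 0 to \<open>k\<close> are all large, giving \<open>Suc k\<close>
    drops; this is the source of the -1.\<close>
  have "dist2 (Suc k) \<le> dist2 0 - \<nu> * \<eta> * real (Suc k) / (8 * L\<^sub>1\<^sup>2)"
    using large_mono[OF _ assms] by (intro dist2_all_large) auto
  then have "\<nu> * \<eta> * real (Suc k) / (8 * L\<^sub>1\<^sup>2) \<le> dist2 0"
    using dist2_nonneg[of "Suc k"] by linarith
  then show ?thesis using nu_pos eta_pos L1_pos by (simp add: field_simps)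
qed

definition num_large :: "nat \<Rightarrow> nat" where "num_large N = card {k \<in> {..<N}. large k}"

lemma large_iff: "k < N \<Longrightarrow> large k \<longleftrightarrow> k < num_large N"
  using down_closed_eq_lessThan_card[of large N] large_mono unfolding num_large_def by blast

lemma num_large_le: "num_large N \<le> N"
  unfolding num_large_def using card_mono[of "{..<N}" "{k \<in> {..<N}. large k}"] by auto

lemma dist2_num_large: "dist2 (num_large N) \<le> dist2 0 - \<nu> * \<eta> * real (num_large N) / (8 * L\<^sub>1\<^sup>2)"
proof (rule dist2_all_large)
  fix j assume "j < num_large N"
  then show "large j" using large_iff[of j N] num_large_le[of N] by linarith
qed

section \<open>Sublinear rate for the function gap\<close>

lemma gap_bound:
  fixes N :: nat
  assumes N: "real N > 8 * L\<^sub>1\<^sup>2 * dist2 0 / (\<nu> * \<eta>) - 1"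
  defines "T \<equiv> num_large N"
  defines "B \<equiv> 2 * L\<^sub>0 * dist2 0 / (\<eta> * (real N + 1 - real T))
    - \<nu> * L\<^sub>0 * real T / (4 * L\<^sub>1\<^sup>2 * (real N + 1 - real T))"
  shows "gap N \<le> B" and "B \<le> 2 * L\<^sub>0 * dist2 0 / (\<eta> * (real N + 1))"
proof -
  have T: "T \<le> N" unfolding T_def by (rule num_large_le)
  have smallN: "\<not> large N" using large_index_le[of N] N by linarith
  have small: "\<not> large k" if "T \<le> k" "k \<le> N" for k
    using that smallN large_iff[of k N] by (cases "k = N") (auto simp: T_def)
  \<comment> \<open>Since \<open>N\<close> itself is small, the step from \<open>x N\<close> to
    \<open>x (Suc N)\<close> counts too: \<open>m\<close> runs up to \<open>Suc N - T\<close>. Each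
    gap is replaced by the last one, \<open>gap N\<close>.\<close>
  have "dist2 (T + m) + real m * (\<eta> / (2 * L\<^sub>0) * gap N) \<le> dist2 T" if "T + m \<le> Suc N" for m
    using that
  proof (induction m)
    case (Suc m)
    have "dist2 (Suc (T + m)) \<le> dist2 (T + m) - \<eta> / (2 * L\<^sub>0) * gap (T + m)"
      using Suc.prems by (intro dist2_small small) auto
    moreover have "\<eta> / (2 * L\<^sub>0) * gap N \<le> \<eta> / (2 * L\<^sub>0) * gap (T + m)"
      using Suc.prems eta_pos L0_pos by (intro mult_left_mono gap_antimono) auto
    moreover have "real (Suc m) * (\<eta> / (2 * L\<^sub>0) * gap N)
        = real m * (\<eta> / (2 * L\<^sub>0) * gap N) + \<eta> / (2 * L\<^sub>0) * gap N"
      by (simp only: of_nat_Suc distrib_right mult_1 add.commute)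
    moreover have "dist2 (T + m) + real m * (\<eta> / (2 * L\<^sub>0) * gap N) \<le> dist2 T"
      using Suc by simp
    ultimately have "dist2 (Suc (T + m)) + real (Suc m) * (\<eta> / (2 * L\<^sub>0) * gap N) \<le> dist2 T"
      by linarith
    then show ?case by simp
  qed simp
  from this[of "Suc N - T"] have "real (Suc N - T) * (\<eta> / (2 * L\<^sub>0) * gap N) \<le> dist2 T"
    using T dist2_nonneg[of "Suc N"] by simp
  also have "\<dots> \<le> dist2 0 - \<nu> * \<eta> * real T / (8 * L\<^sub>1\<^sup>2)"
    unfolding T_def by (rule dist2_num_large)
  finally have *: "(real N + 1 - real T) * (\<eta> / (2 * L\<^sub>0) * gap N)
      \<le> dist2 0 - \<nu> * \<eta> * real T / (8 * L\<^sub>1\<^sup>2)"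
    using T by (simp add: of_nat_diff add.commute)
  define D where "D = real N + 1 - real T"
  define a where "a = 2 * L\<^sub>0 * dist2 0 / \<eta>"
  define b where "b = \<nu> * L\<^sub>0 / (4 * L\<^sub>1\<^sup>2)"
  have D0: "D > 0" using T by (simp add: D_def)
  have B: "B = (a - b * real T) / D"
    by (simp add: B_def a_def b_def D_def[symmetric] diff_divide_distrib)
  have "D * gap N = 2 * L\<^sub>0 / \<eta> * (D * (\<eta> / (2 * L\<^sub>0) * gap N))"
    using eta_pos L0_pos by simp
  also have "\<dots> \<le> 2 * L\<^sub>0 / \<eta> * (dist2 0 - \<nu> * \<eta> * real T / (8 * L\<^sub>1\<^sup>2))"
    unfolding D_def using eta_pos L0_pos by (intro mult_left_mono *) auto
  also have "\<dots> = a - b * real T"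
    using eta_pos L1_pos by (simp add: a_def b_def field_simps)
  finally show "gap N \<le> B" using D0 by (simp add: B field_simps)
  \<comment> \<open>The lower bound on \<open>N\<close> becomes
    \<open>a \<le> b * (real N + 1)\<close>, which is what cross-multiplying
    \<open>(a - b * real T) / D \<le> a / (real N + 1)\<close> calls for.\<close>
  have "8 * L\<^sub>1\<^sup>2 * dist2 0 < (real N + 1) * (\<nu> * \<eta>)"
    using N nu_pos eta_pos by (simp add: field_simps)
  then have "L\<^sub>0 * (8 * L\<^sub>1\<^sup>2 * dist2 0) \<le> L\<^sub>0 * ((real N + 1) * (\<nu> * \<eta>))"
    using L0_pos by simp
  then have "a \<le> b * (real N + 1)"
    using eta_pos L1_pos by (simp add: a_def b_def field_simps)
  then have "a * real T \<le> b * (real N + 1) * real T" by (intro mult_right_mono) auto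
  then have "(a - b * real T) * (real N + 1) \<le> a * D"
    by (simp add: D_def algebra_simps)
  then have "B \<le> a / (real N + 1)" using D0 by (simp add: B field_simps)
  then show "B \<le> 2 * L\<^sub>0 * dist2 0 / (\<eta> * (real N + 1))" by (simp add: a_def)
qed

section \<open>Linear rate under strong convexity\<close>

text \<open>Compare strong convexity and \<open>descent\<close> between \<open>xstar\<close> and a point at distance \<open>1 / L\<^sub>1\<close>.
  The sharp bound \<open>\<mu> \<le> L\<^sub>0\<close> would need a limit.\<close>

lemma strong_convexity_le:
  assumes "strongly_convex \<mu> f"
  shows "\<mu> \<le> 3 * L\<^sub>0"
proof -
  obtain v :: 'a where v: "norm v = 1 / L\<^sub>1"
    using vector_choose_size[of "1 / L\<^sub>1"] L1_pos by auto
  have "f (xstar + v) \<ge> f xstar + \<mu> / 2 * (norm v)\<^sup>2"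
    using assms[unfolded strongly_convex_def, rule_format, of xstar "xstar + v"]
    by (simp add: grad_xstar)
  moreover have "f (xstar + v) \<le> f xstar + L\<^sub>0 / 2 * exp 1 * (norm v)\<^sup>2"
    using descent[of "xstar + v" xstar] L1_pos by (simp add: grad_xstar A_def v)
  ultimately have "\<mu> / 2 * (norm v)\<^sup>2 \<le> L\<^sub>0 / 2 * exp 1 * (norm v)\<^sup>2" by linarith
  then have "\<mu> \<le> L\<^sub>0 * exp 1" using v L1_pos by simp
  also have "\<dots> \<le> L\<^sub>0 * 3" using exp_le L0_pos by (intro mult_left_mono) auto
  finally show ?thesis by simp
qed

text \<open>The first \<open>T\<close> steps supply the bracket. At every later index before
  \<open>N\<close>, strong convexity at \<open>xstar\<close>, where the gradient vanishes, bounds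
  the gap below by \<open>\<mu> / 2\<close> times the squared distance, so
  \<open>dist2_small\<close> contracts by \<open>q\<close>.\<close>

lemma dist2_bound:
  fixes N :: nat
  assumes mu: "strongly_convex \<mu> f"
  defines "q \<equiv> 1 - \<mu> * \<eta> / (4 * L\<^sub>0)"
  defines "T \<equiv> num_large N"
  defines "B \<equiv> q ^ (N - T) * (dist2 0 - \<nu> * \<eta> * real T / (8 * L\<^sub>1\<^sup>2))"
  shows "dist2 N \<le> B" and "B \<le> q ^ (N - T) * dist2 0"
proof -
  have T: "T \<le> N" unfolding T_def by (rule num_large_le)
  \<comment> \<open>Nonnegativity of \<open>q\<close> lets the contractions be chained; it follows
    from \<open>\<mu> \<le> 3 * L\<^sub>0\<close> and \<open>\<eta> < 1\<close>.\<close>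
  have "\<mu> * \<eta> \<le> 3 * L\<^sub>0 * \<eta>"
    using strong_convexity_le[OF mu] eta_pos by (intro mult_right_mono) auto
  also have "\<dots> \<le> 3 * L\<^sub>0 * 1"
    using eta_le nu_less_1 L0_pos by (intro mult_left_mono) auto
  finally have "\<mu> * \<eta> \<le> 4 * L\<^sub>0" using L0_pos by simp
  then have q: "q \<ge> 0" using L0_pos by (simp add: q_def)
  have "dist2 (T + m) \<le> q ^ m * dist2 T" if "T + m \<le> N" for m
    using that
  proof (induction m)
    case (Suc m)
    have "gap (T + m) \<ge> \<mu> / 2 * dist2 (T + m)"
      using mu[unfolded strongly_convex_def, rule_format, of xstar "x (T + m)"]
      by (simp add: grad_xstar gap_def dist2_def norm_minus_commute)
    then have "\<eta> / (2 * L\<^sub>0) * gap (T + m) \<ge> \<eta> / (2 * L\<^sub>0) * (\<mu> / 2 * dist2 (T + m))"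
      using eta_pos L0_pos by (intro mult_left_mono) auto
    moreover have "dist2 (Suc (T + m)) \<le> dist2 (T + m) - \<eta> / (2 * L\<^sub>0) * gap (T + m)"
      using Suc.prems large_iff[of "T + m" N] by (intro dist2_small) (simp add: T_def)
    ultimately have "dist2 (Suc (T + m)) \<le> q * dist2 (T + m)"
      by (simp add: q_def algebra_simps)
    also have "\<dots> \<le> q * (q ^ m * dist2 T)"
      using q Suc by (intro mult_left_mono) auto
    finally show ?case by (simp add: mult.assoc)
  qed simp
  from this[of "N - T"] have "dist2 N \<le> q ^ (N - T) * dist2 T" using T by simp
  also have "\<dots> \<le> B"
    unfolding B_def T_def using q by (intro mult_left_mono dist2_num_large) auto
  finally show "dist2 N \<le> B" .
  show "B \<le> q ^ (N - T) * dist2 0"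
    unfolding B_def using q nu_pos eta_pos by (intro mult_left_mono) auto
qed

end

theorem theoremD3:
  fixes f :: "'a::euclidean_space \<Rightarrow> real"
    and x :: "nat \<Rightarrow> 'a"
    and xstar :: 'a
    and L\<^sub>0 L\<^sub>1 \<nu> \<eta> :: real
  assumes "f differentiable_on UNIV"
    and "strongly_convex 0 f"
    and "L\<^sub>0 > 0" and "L\<^sub>1 > 0"
    and "sym_smooth L\<^sub>0 L\<^sub>1 f"
    and "is_arg_min f (\<lambda>_. True) xstar"
    and "\<nu> = exp (- \<nu>)"
    and "0 < \<eta>" and "\<eta> \<le> \<nu> / 2"
    and "\<And>k. x (Suc k) = x k - (\<eta> / (L\<^sub>0 + L\<^sub>1 * norm (grad f (x k)))) *\<^sub>R grad f (x k)"
  shows "(\<forall>k. norm (grad f (x k)) \<ge> L\<^sub>0 / L\<^sub>1 \<longrightarrow>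
            real k \<le> 8 * L\<^sub>1\<^sup>2 * (norm (x 0 - xstar))\<^sup>2 / (\<nu> * \<eta>) - 1 \<and>
            (norm (x (Suc k) - xstar))\<^sup>2 \<le> (norm (x k - xstar))\<^sup>2 - \<nu> * \<eta> / (8 * L\<^sub>1\<^sup>2))
       \<and> (\<forall>N::nat. real N > 8 * L\<^sub>1\<^sup>2 * (norm (x 0 - xstar))\<^sup>2 / (\<nu> * \<eta>) - 1 \<longrightarrow>
            (let T = card {k \<in> {..<N}. norm (grad f (x k)) \<ge> L\<^sub>0 / L\<^sub>1};
                 B = 2 * L\<^sub>0 * (norm (x 0 - xstar))\<^sup>2 / (\<eta> * (real N + 1 - real T))
                       - \<nu> * L\<^sub>0 * real T / (4 * L\<^sub>1\<^sup>2 * (real N + 1 - real T))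
             in f (x N) - f xstar \<le> B \<and>
                B \<le> 2 * L\<^sub>0 * (norm (x 0 - xstar))\<^sup>2 / (\<eta> * (real N + 1))))
       \<and> (\<forall>(\<mu>::real) (N::nat). \<mu> > 0 \<longrightarrow> strongly_convex \<mu> f \<longrightarrow>
            real N > 8 * L\<^sub>1\<^sup>2 * (norm (x 0 - xstar))\<^sup>2 / \<eta> - 1 \<longrightarrow>
            (let T = card {k \<in> {..<N}. norm (grad f (x k)) \<ge> L\<^sub>0 / L\<^sub>1};
                 B = (1 - \<mu> * \<eta> / (4 * L\<^sub>0)) ^ (N - T)
                       * ((norm (x 0 - xstar))\<^sup>2 - \<nu> * \<eta> * real T / (8 * L\<^sub>1\<^sup>2))
             in (norm (x N - xstar))\<^sup>2 \<le> B \<and>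
                B \<le> (1 - \<mu> * \<eta> / (4 * L\<^sub>0)) ^ (N - T) * (norm (x 0 - xstar))\<^sup>2))"
proof -
  interpret sym_smooth_gd f L\<^sub>0 L\<^sub>1 x xstar \<nu> \<eta>
  proof -
    \<comment> \<open>Interpreted first so that \<open>A_def\<close> can identify the step size of
      the iteration.\<close>
    interpret convex_sym_smooth f L\<^sub>0 L\<^sub>1
      using assms by unfold_locales
    show "sym_smooth_gd f L\<^sub>0 L\<^sub>1 x xstar \<nu> \<eta>"
      using assms by unfold_locales (auto simp: is_arg_min_linorder A_def)
  qed
  show ?thesis
    unfolding Let_def
  proof (intro conjI allI impI)
    fix k assume "L\<^sub>0 / L\<^sub>1 \<le> norm (grad f (x k))"
    then have k: "large k" by (simp add: large_def)
    show "real k \<le> 8 * L\<^sub>1\<^sup>2 * (norm (x 0 - xstar))\<^sup>2 / (\<nu> * \<eta>) - 1"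
      using large_index_le[OF k] unfolding dist2_def .
    show "(norm (x (Suc k) - xstar))\<^sup>2 \<le> (norm (x k - xstar))\<^sup>2 - \<nu> * \<eta> / (8 * L\<^sub>1\<^sup>2)"
      using dist2_large[OF k] unfolding dist2_def .
  qed (rule gap_bound[unfolded gap_def dist2_def num_large_def large_def]
      dist2_bound[unfolded dist2_def num_large_def large_def], assumption)+
qed

end
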